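(* Let $(\mathbb F,|\cdot|)$ be a non-archimedean valued field, let $d$ be an ultra-pseudometric on $\overline X=X\cup\{\mathbf 0\}$, where $X$ is a nonempty set, and let $\|\cdot\|$ be the Kantorovich ultra-seminorm for $d$ on $L_{\mathbb F}(X)$. Let $u=\sum_{i=1}^n\lambda_ix_i\in L_{\mathbb F}(X)$ (normal form), $m=|\operatorname{supp}(u)|$, $\operatorname{supp}(u)=\{x_1,\dots,x_m\}$, and let $G_u$ be the additive subgroup of $\mathbb F$ generated by $\lambda_1,\dots,\lambda_n$. Then $$\|u\|=\min\Big\{\max_{1\le i,j\le m}|c_{ij}|\,d(x_i,x_j)\;:\; c_{ij}\in G_u,\ \sum_{j=1}^m c_{ij}-\sum_{j=1}^m c_{ji}=\lambda_i\ \text{ for all }1\le i\le n\Big\};$$ that is, the minimum on the right exists and equals $\|u\|$.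
   Context: $L_{\mathbb F}(X)$ is the free $\mathbb F$-vector space on the nonempty set $X$; $\mathbf 0\notin X$ is its zero vector and $\overline X:=X\cup\{\mathbf 0\}\subseteq L_{\mathbb F}(X)$. $L^0_{\mathbb F}(X)$ is the kernel of the functional $\sum\lambda_ix_i\mapsto\sum\lambda_i$. Normal form and support: every nonzero $u\in L_{\mathbb F}(X)$ is written $u=\sum_{i=1}^n\lambda_ix_i$ with the $x_i\in X$ pairwise distinct and all $\lambda_i\ne 0_{\mathbb F}$. If $u\in L^0_{\mathbb F}(X)$, $\operatorname{supp}(u):=\{x_1,\dots,x_n\}$ (so $m=n$); otherwise $\operatorname{supp}(u):=\{x_1,\dots,x_n,x_{n+1}\}$ with $x_{n+1}=\mathbf 0$ (so $m=n+1$). A non-archimedean valued field is a field with a valuation $|\cdot|:\mathbb F\to[0,\infty)$ with $|x|=0\iff x=0$, $|xy|=|x||y|$, $|x+y|\le\max\{|x|,|y|\}$ (the trivial valuation is allowed). An ultra-pseudometric is a pseudometric with $d(x,z)\le\max\{d(x,y),d(y,z)\}$. An ultra-seminorm on an $\mathbb F$-vector space is a map $p\ge0$ with $p(0)=0$, $p(x+y)\le\max\{p(x),p(y)\}$, $p(\alpha x)=|\alpha|p(x)$. The Kantorovich ultra-seminorm for $d$ is the (pointwise) maximal ultra-seminorm $p$ on $L_{\mathbb F}(X)$ with $p(x-y)=d(x,y)$ for all $x,y\in\overline X$; it exists and is given by $$\|u\|=\inf\Big\{\max_{1\le i\le k}|s_i|d(a_i,b_i): u=\sum_{i=1}^k s_i(a_i-b_i),\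 a_i,b_i\in\overline X,\ s_i\in\mathbb F\Big\}.$$ *)

theory Defs
  imports
    Complex_Main
    "HOL-Library.Poly_Mapping"
    "HOL-Computational_Algebra.Group_Closure"
begin

definition nonarch_valuation :: "('f::field \<Rightarrow> real) \<Rightarrow> bool" where
  "nonarch_valuation v \<longleftrightarrow>
     (\<forall>a. 0 \<le> v a) \<and> (\<forall>a. v a = 0 \<longleftrightarrow> a = 0) \<and>
     (\<forall>a b. v (a * b) = v a * v b) \<and> (\<forall>a b. v (a + b) \<le> max (v a) (v b))"

text \<open>
  The nonempty set \<open>X\<close> is the type \<open>'a\<close>, and the free vector space on \<open>X\<close> over the field \<open>'f\<close>
  is the type \<open>'a \<Rightarrow>\<^sub>0 'f\<close> of finitely supported functions. The library does not provide scalar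
  multiplication on this type.
\<close>

definition smul :: "'f::field \<Rightarrow> ('a \<Rightarrow>\<^sub>0 'f) \<Rightarrow> ('a \<Rightarrow>\<^sub>0 'f)" where
  "smul s u = Poly_Mapping.map (\<lambda>t. s * t) u"

lemma lookup_smul: "Poly_Mapping.lookup (smul s u) a = s * Poly_Mapping.lookup u a"
  by (simp add: smul_def Poly_Mapping.map.rep_eq when_def)

text \<open>\<open>X\<close> as a subset of the free vector space, and \<open>X\<close> together with the zero vector.\<close>

definition gens :: "('a \<Rightarrow>\<^sub>0 'f::field) set" where
  "gens = {Poly_Mapping.single a 1 | a. True}"

definition gens0 :: "('a \<Rightarrow>\<^sub>0 'f::field) set" where
  "gens0 = insert 0 gens"

definition ultra_pseudometric_on :: "'b set \<Rightarrow> ('b \<Rightarrow> 'b \<Rightarrow> real) \<Rightarrow> bool" where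
  "ultra_pseudometric_on S d \<longleftrightarrow>
     (\<forall>x\<in>S. \<forall>y\<in>S. 0 \<le> d x y) \<and> (\<forall>x\<in>S. d x x = 0) \<and>
     (\<forall>x\<in>S. \<forall>y\<in>S. d x y = d y x) \<and>
     (\<forall>x\<in>S. \<forall>y\<in>S. \<forall>z\<in>S. d x z \<le> max (d x y) (d y z))"

definition ultra_seminorm :: "('f::field \<Rightarrow> real) \<Rightarrow> (('a \<Rightarrow>\<^sub>0 'f) \<Rightarrow> real) \<Rightarrow> bool" where
  "ultra_seminorm v p \<longleftrightarrow>
     (\<forall>u. 0 \<le> p u) \<and> p 0 = 0 \<and>
     (\<forall>u w. p (u + w) \<le> max (p u) (p w)) \<and> (\<forall>s u. p (smul s u) = v s * p u)"

definition seminorm_extends ::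
  "(('a \<Rightarrow>\<^sub>0 'f::field) \<Rightarrow> ('a \<Rightarrow>\<^sub>0 'f) \<Rightarrow> real) \<Rightarrow> (('a \<Rightarrow>\<^sub>0 'f) \<Rightarrow> real) \<Rightarrow> bool" where
  "seminorm_extends d p \<longleftrightarrow> (\<forall>x\<in>gens0. \<forall>y\<in>gens0. p (x - y) = d x y)"

text \<open>
  The Kantorovich ultra-seminorm is the pointwise largest ultra-seminorm extending \<open>d\<close>. It is
  unique by maximality; it exists when \<open>v\<close> is a non-archimedean valuation and \<open>d\<close> is an
  ultra-pseudometric on \<open>gens0\<close>. Only the values of \<open>d\<close> on \<open>gens0\<close> matter.
\<close>

definition is_kantorovich ::
  "('f::field \<Rightarrow> real) \<Rightarrow> (('a \<Rightarrow>\<^sub>0 'f) \<Rightarrow> ('a \<Rightarrow>\<^sub>0 'f) \<Rightarrow> real) \<Rightarrow> (('a \<Rightarrow>\<^sub>0 'f) \<Rightarrow> real) \<Rightarrow> bool"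
  where
  "is_kantorovich v d p \<longleftrightarrow>
     ultra_seminorm v p \<and> seminorm_extends d p \<and>
     (\<forall>q. ultra_seminorm v q \<and> seminorm_extends d q \<longrightarrow> (\<forall>u. q u \<le> p u))"

definition kantorovich ::
  "('f::field \<Rightarrow> real) \<Rightarrow> (('a \<Rightarrow>\<^sub>0 'f) \<Rightarrow> ('a \<Rightarrow>\<^sub>0 'f) \<Rightarrow> real) \<Rightarrow> ('a \<Rightarrow>\<^sub>0 'f) \<Rightarrow> real" where
  "kantorovich v d = (THE p. is_kantorovich v d p)"

definition coeff_sum :: "('a \<Rightarrow>\<^sub>0 'f::field) \<Rightarrow> 'f" where
  "coeff_sum u = (\<Sum>a\<in>Poly_Mapping.keys u. Poly_Mapping.lookup u a)"

text \<open>The kernel of the functional \<open>coeff_sum\<close>.\<close>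

definition L0 :: "('a \<Rightarrow>\<^sub>0 'f::field) set" where
  "L0 = {u. coeff_sum u = 0}"

text \<open>
  The zero vector belongs to the support exactly when the coefficients do not sum to zero. This
  differs from \<open>Poly_Mapping.keys\<close>, which is a subset of the index type.
\<close>

definition supp :: "('a \<Rightarrow>\<^sub>0 'f::field) \<Rightarrow> ('a \<Rightarrow>\<^sub>0 'f) set" where
  "supp u = (\<lambda>a. Poly_Mapping.single a 1) ` Poly_Mapping.keys u \<union> (if u \<in> L0 then {} else {0})"

definition normal_form ::
  "('a \<Rightarrow>\<^sub>0 'f::field) \<Rightarrow> nat \<Rightarrow> (nat \<Rightarrow> 'f) \<Rightarrow> (nat \<Rightarrow> ('a \<Rightarrow>\<^sub>0 'f)) \<Rightarrow> bool" where
  "normal_form u n lam x \<longleftrightarrow>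
     (\<forall>i\<in>{1..n}. x i \<in> gens) \<and> inj_on x {1..n} \<and> (\<forall>i\<in>{1..n}. lam i \<noteq> 0) \<and>
     u = (\<Sum>i=1..n. smul (lam i) (x i))"

text \<open>
  The \<open>m\<times>m\<close> matrices with entries in the additive group generated by the coefficients that
  satisfy the flow condition at the indices \<open>1..n\<close>; no condition is imposed at the index of the
  zero vector, if there is one.
\<close>

definition admissible :: "nat \<Rightarrow> nat \<Rightarrow> (nat \<Rightarrow> 'f::field) \<Rightarrow> (nat \<Rightarrow> nat \<Rightarrow> 'f) \<Rightarrow> bool" where
  "admissible m n lam c \<longleftrightarrow>
     (\<forall>i\<in>{1..m}. \<forall>j\<in>{1..m}. c i j \<in> group_closure (lam ` {1..n})) \<and>
     (\<forall>i\<in>{1..n}. (\<Sum>j=1..m. c i j) - (\<Sum>j=1..m. c j i) = lam i)"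

definition plan_cost ::
  "('f::field \<Rightarrow> real) \<Rightarrow> ('b \<Rightarrow> 'b \<Rightarrow> real) \<Rightarrow> nat \<Rightarrow> (nat \<Rightarrow> 'b) \<Rightarrow> (nat \<Rightarrow> nat \<Rightarrow> 'f) \<Rightarrow> real" where
  "plan_cost v d m x c = Max {v (c i j) * d (x i) (x j) | i j. i \<in> {1..m} \<and> j \<in> {1..m}}"

end

theory Submission
  imports Defs
begin

text \<open>
  Give the zero vector the coefficient that makes the total mass of \<open>u\<close> vanish. The supremum of
  \<open>r * v \<mu>\<close>, where \<open>\<mu>\<close> is the mass of an open ball of radius \<open>r\<close>, is an ultra-seminorm extending \<open>d\<close>.
  Conversely, merging the two closest points of the support again and again transports the mass
  of \<open>u\<close> along a minimum spanning tree, and no step costs more than that supremum: a closest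
  pair at distance \<open>\<delta>\<close> consists of points that are alone in their balls of radius \<open>\<delta>\<close>. Since every
  ultra-seminorm extending \<open>d\<close> is bounded by the cost of every plan, the supremum is the
  Kantorovich ultra-seminorm and the plan is optimal.
\<close>

section \<open>Valuations, scalar multiplication and finite sums in the free vector space\<close>

lemma nonarch_valuation_minus:
  assumes "nonarch_valuation v"
  shows "v (- a) = v a"
proof -
  have v: "v (x * y) = v x * v y" "0 \<le> v x" "v x = 0 \<longleftrightarrow> x = 0" for x y
    using assms by (auto simp: nonarch_valuation_def)
  have "v 1 * v 1 = v 1" "v 1 \<noteq> 0"
    using v(1)[of 1 1] v(3)[of 1] by auto
  then have "v 1 = 1"
    by simp
  then have "(v (- 1))\<^sup>2 = 1"
    using v(1)[of "- 1" "- 1"] by (simp add: power2_eq_square)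
  then have "v (- 1) = 1"
    using v(2)[of "- 1"] by (auto simp: power2_eq_1_iff)
  then show ?thesis
    using v(1)[of "- 1" a] by simp
qed

lemma single_one_neq_zero [simp]: "Poly_Mapping.single a (1::'f::field) \<noteq> 0"
  by (metis lookup_single_eq lookup_zero zero_neq_one)

lemma single_one_eq_iff:
  "Poly_Mapping.single a (1::'f::field) = Poly_Mapping.single b 1 \<longleftrightarrow> a = b"
  by (metis lookup_single_eq lookup_single_not_eq zero_neq_one)

lemma zero_notin_gens [simp]: "0 \<notin> gens"
  by (auto simp: gens_def dest: sym)

lemma sum_single_lookup:
  "(\<Sum>a\<in>Poly_Mapping.keys u. Poly_Mapping.single a (Poly_Mapping.lookup u a)) = u"
proof (rule poly_mapping_eqI)
  fix b
  have "(\<Sum>a\<in>Poly_Mapping.keys u. Poly_Mapping.lookup u a when a = b)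
      = (\<Sum>a\<in>Poly_Mapping.keys u. if a = b then Poly_Mapping.lookup u b else 0)"
    by (rule sum.cong) (auto simp: when_def)
  then show "Poly_Mapping.lookup
      (\<Sum>a\<in>Poly_Mapping.keys u. Poly_Mapping.single a (Poly_Mapping.lookup u a)) b
      = Poly_Mapping.lookup u b"
    by (simp add: lookup_sum lookup_single in_keys_iff)
qed

lemma smul_zero_right [simp]: "smul s 0 = 0"
  and smul_zero_left [simp]: "smul 0 u = 0"
  and smul_diff_right: "smul s (u - w) = smul s u - smul s w"
  and smul_add_left: "smul (s + t) u = smul s u + smul t u"
  and smul_diff_left: "smul (s - t) u = smul s u - smul t u"
  and smul_single: "smul s (Poly_Mapping.single a t) = Poly_Mapping.single a (s * t)"
  by (rule poly_mapping_eqI;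
      simp add: lookup_smul lookup_add lookup_minus lookup_single when_def algebra_simps)+

lemma smul_sum_left: "smul (\<Sum>i\<in>I. s i) u = (\<Sum>i\<in>I. smul (s i) u)"
  by (induction I rule: infinite_finite_induct) (simp_all add: smul_add_left)

lemma ultra_seminorm_sum_le:
  assumes "ultra_seminorm v p" "finite I" "0 \<le> M" "\<And>i. i \<in> I \<Longrightarrow> p (g i) \<le> M"
  shows "p (\<Sum>i\<in>I. g i) \<le> M"
  using assms(2,4)
proof (induction I rule: finite_induct)
  case empty
  then show ?case using assms(1,3) by (simp add: ultra_seminorm_def)
next
  case (insert i I)
  have "p (g i + (\<Sum>i\<in>I. g i)) \<le> max (p (g i)) (p (\<Sum>i\<in>I. g i))"
    using assms(1) by (simp add: ultra_seminorm_def)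
  also have "\<dots> \<le> M"
    using insert by simp
  finally show ?case using insert by simp
qed

text \<open>The set under \<open>Max\<close> is the image of a finite product, which
  \<open>1 \<le> m\<close> makes nonempty, so \<open>Max_le_iff\<close> applies.\<close>

lemma plan_cost_le_iff:
  assumes "1 \<le> m"
  shows "plan_cost v d m x c \<le> M \<longleftrightarrow> (\<forall>i\<in>{1..m}. \<forall>j\<in>{1..m}. v (c i j) * d (x i) (x j) \<le> M)"
proof -
  have *: "{v (c i j) * d (x i) (x j) | i j. i \<in> {1..m} \<and> j \<in> {1..m}}
      = (\<lambda>(i, j). v (c i j) * d (x i) (x j)) ` ({1..m} \<times> {1..m})"
    by force
  show ?thesis
    unfolding plan_cost_def * using assms by (subst Max_le_iff) auto
qed

section \<open>Transport of mass on a finite ultra-pseudometric space\<close>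

text \<open>The induction ships the whole mass of \<open>b\<close> to \<open>a\<close> for a closest
  pair \<open>a\<close>, \<open>b\<close> and solves the problem on \<open>S - {b}\<close> with the
  same \<open>K\<close>. The bound on ball masses survives: small balls are single points, where the
  strong triangle inequality for \<open>v\<close> bounds \<open>f a + f b\<close>, and larger balls
  contain both of \<open>a\<close>, \<open>b\<close> or neither. Requiring \<open>c\<close> to
  vanish off \<open>S\<close> makes the row and column of \<open>b\<close> zero when the plan is
  extended back.\<close>

lemma exists_flow:
  fixes v :: "'f::field \<Rightarrow> real" and D :: "'b \<Rightarrow> 'b \<Rightarrow> real"
  assumes v: "nonarch_valuation v" and "0 \<le> K"
    and "finite S" "ultra_pseudometric_on S D"
    and "\<And>i. i \<in> S \<Longrightarrow> f i \<in> group_closure A" "sum f S = 0"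
    and "\<And>y r. y \<in> S \<Longrightarrow> 0 \<le> r \<Longrightarrow> v (\<Sum>i\<in>{i\<in>S. D y i < r}. f i) * r \<le> K"
  shows "\<exists>c. (\<forall>i j. c i j \<in> group_closure A) \<and> (\<forall>i j. i \<notin> S \<or> j \<notin> S \<longrightarrow> c i j = 0) \<and>
           (\<forall>i\<in>S. (\<Sum>j\<in>S. c i j) - (\<Sum>j\<in>S. c j i) = f i) \<and>
           (\<forall>i\<in>S. \<forall>j\<in>S. v (c i j) * D i j \<le> K)"
  using assms(3-)
proof (induction "card S" arbitrary: S f rule: less_induct)
  case less
  have v0 [simp]: "v 0 = 0" and v_add: "\<And>a b. v (a + b) \<le> max (v a) (v b)"
    using v by (auto simp: nonarch_valuation_def)
  show ?case
  proof (cases "\<exists>i\<in>S. \<exists>j\<in>S. i \<noteq> j")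
    case False
    \<comment> \<open>With at most one point, zero total mass leaves nothing to move.\<close>
    have "f i = 0" if "i \<in> S" for i
    proof -
      have "S = {i}"
        using False that by blast
      then show ?thesis
        using less.prems(4) by simp
    qed
    then show ?thesis
      using \<open>0 \<le> K\<close> by (intro exI[of _ "\<lambda>_ _. 0"]) simp
  next
    case True
    define P where "P = {(i, j). i \<in> S \<and> j \<in> S \<and> i \<noteq> j}"
    have "finite P"
      by (rule finite_subset[of _ "S \<times> S"]) (use less.prems(1) in \<open>auto simp: P_def\<close>)
    moreover have "P \<noteq> {}"
      using True by (auto simp: P_def)
    ultimately obtain z where z: "z \<in> P" "\<And>w. w \<in> P \<Longrightarrow> case_prod D z \<le> case_prod D w"
      using arg_min_if_finite(1)[of P "case_prod D"] arg_min_least[of P _ "case_prod D"] by blast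
    obtain a b where ab: "z = (a, b)"
      by (cases z)
    have a: "a \<in> S" and b: "b \<in> S" and "a \<noteq> b"
      using z(1) by (auto simp: ab P_def)
    define \<delta> where "\<delta> = D a b"
    have min: "\<delta> \<le> D i j" if "i \<in> S" "j \<in> S" "i \<noteq> j" for i j
      using z(2)[of "(i, j)"] that by (auto simp: ab P_def \<delta>_def)
    have D: "\<And>i j. i \<in> S \<Longrightarrow> j \<in> S \<Longrightarrow> 0 \<le> D i j" "\<And>i. i \<in> S \<Longrightarrow> D i i = 0"
      "\<And>i j. i \<in> S \<Longrightarrow> j \<in> S \<Longrightarrow> D i j = D j i"
      "\<And>i j k. i \<in> S \<Longrightarrow> j \<in> S \<Longrightarrow> k \<in> S \<Longrightarrow> D i k \<le> max (D i j) (D j k)"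
      using less.prems(2) unfolding ultra_pseudometric_on_def by blast+
    have \<delta>: "0 \<le> \<delta>"
      using D(1) a b by (simp add: \<delta>_def)
    \<comment> \<open>Distinct points are at least \<open>\<delta>\<close> apart, so an open ball of
      radius \<open>0 < r \<le> \<delta>\<close> is a single point. At \<open>r = 0\<close> the ball
      is empty, but the factor \<open>r\<close> makes the bound trivial.\<close>
    have single: "v (f y) * r \<le> K" if "y \<in> S" "0 \<le> r" "r \<le> \<delta>" for y r
    proof (cases "r = 0")
      case False
      then have "{i \<in> S. D y i < r} = {y}"
        using that D(2) min by force
      then show ?thesis
        using less.prems(5)[OF that(1,2)] by simp
    qed (use \<open>0 \<le> K\<close> in simp)
    let ?T = "S - {b}"
    define g where "g = f(a := f a + f b)"
    \<comment> \<open>Moving mass from \<open>b\<close> to \<open>a\<close> preserves the total over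
      a set containing both; \<open>Y\<close> is such a set with \<open>b\<close> deleted.\<close>
    have sum_g: "sum g Y = sum f (insert b Y)" if "finite Y" "a \<in> Y" "b \<notin> Y" for Y
    proof -
      have "sum g Y = g a + sum g (Y - {a})"
        using that by (simp add: sum.remove)
      also have "sum g (Y - {a}) = sum f (Y - {a})"
        by (intro sum.cong) (auto simp: g_def)
      also have "g a + \<dots> = f b + (f a + sum f (Y - {a}))"
        by (simp add: g_def)
      also have "f a + sum f (Y - {a}) = sum f Y"
        using that by (simp add: sum.remove)
      finally show ?thesis
        using that by simp
    qed
    have "\<exists>c. (\<forall>i j. c i j \<in> group_closure A) \<and> (\<forall>i j. i \<notin> ?T \<or> j \<notin> ?T \<longrightarrow> c i j = 0) \<and>
           (\<forall>i\<in>?T. (\<Sum>j\<in>?T. c i j) - (\<Sum>j\<in>?T. c j i) = g i) \<and>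
           (\<forall>i\<in>?T. \<forall>j\<in>?T. v (c i j) * D i j \<le> K)"
    proof (rule less.hyps)
      show "card ?T < card S"
        using less.prems(1) b by (rule card_Diff1_less)
      show "finite ?T"
        using less.prems(1) by simp
      show "ultra_pseudometric_on ?T D"
        using less.prems(2) by (simp add: ultra_pseudometric_on_def)
      show "g i \<in> group_closure A" if "i \<in> ?T" for i
        using that less.prems(3) a b by (auto simp: g_def intro: group_closure_add)
      show "sum g ?T = 0"
        using sum_g[of ?T] less.prems(1,4) a b \<open>a \<noteq> b\<close> by (simp add: insert_absorb)
      show "v (\<Sum>i\<in>{i \<in> ?T. D y i < r}. g i) * r \<le> K" if y: "y \<in> ?T" and r: "0 \<le> r" for y r
      proof (cases "r \<le> \<delta>")
        case True
        show ?thesis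
        proof (cases "r = 0")
          case False
          then have "{i \<in> ?T. D y i < r} = {y}"
            using y r True D(2) min[of y] by force
          moreover have "v (g y) * r \<le> K"
          proof (cases "y = a")
            case True
            then have "v (g y) \<le> max (v (f a)) (v (f b))"
              by (simp add: g_def v_add)
            then have "v (g y) * r \<le> max (v (f a) * r) (v (f b) * r)"
              using r by (smt (verit) mult_right_mono)
            then show ?thesis
              using single[OF a r \<open>r \<le> \<delta>\<close>] single[OF b r \<open>r \<le> \<delta>\<close>] by linarith
          qed (use y single r \<open>r \<le> \<delta>\<close> in \<open>auto simp: g_def\<close>)
          ultimately show ?thesis by simp
        qed (use \<open>0 \<le> K\<close> in simp)
      next
        case False
        have yS: "y \<in> S"
          using y by simp
        \<comment> \<open>Since \<open>D a b = \<delta> < r\<close>, the strong triangle inequality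
          carries membership in the ball from either point to the other.\<close>
        have iff: "D y a < r \<longleftrightarrow> D y b < r"
          using D(4)[OF yS a b] D(4)[OF yS b a] D(3)[OF a b] False by (auto simp: \<delta>_def)
        have "(\<Sum>i\<in>{i \<in> ?T. D y i < r}. g i) = (\<Sum>i\<in>{i \<in> S. D y i < r}. f i)"
        proof (cases "D y a < r")
          case True
          then have "insert b {i \<in> ?T. D y i < r} = {i \<in> S. D y i < r}"
            using iff b by auto
          then show ?thesis
            using sum_g[of "{i \<in> ?T. D y i < r}"] True a \<open>a \<noteq> b\<close> less.prems(1) by simp
        next
          case False
          then have *: "{i \<in> ?T. D y i < r} = {i \<in> S. D y i < r}"
            using iff by auto
          show ?thesis
            unfolding * by (rule sum.cong) (use False in \<open>auto simp: g_def\<close>)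
        qed
        then show ?thesis
          using less.prems(5)[OF yS r] by simp
      qed
    qed
    then obtain c where *: "\<forall>i j. c i j \<in> group_closure A"
      "\<forall>i j. i \<notin> ?T \<or> j \<notin> ?T \<longrightarrow> c i j = 0"
      "\<forall>i\<in>?T. (\<Sum>j\<in>?T. c i j) - (\<Sum>j\<in>?T. c j i) = g i"
      "\<forall>i\<in>?T. \<forall>j\<in>?T. v (c i j) * D i j \<le> K"
      by (elim exE conjE)
    note c = *(1)[rule_format] *(2)[rule_format] bspec[OF *(3)] bspec[OF bspec[OF *(4)]]
    \<comment> \<open>The plan \<open>c\<close> is zero at \<open>(b, a)\<close>, so overwriting
      that entry amounts to adding one shipment of \<open>f b\<close> from \<open>b\<close> to
      \<open>a\<close>.\<close>
    define e where "e i j = (if i = b \<and> j = a then f b else c i j)" for i j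
    have c0: "c b j = 0" "c j b = 0" for j
      by (auto intro: c(2))
    have out: "(\<Sum>j\<in>S. e i j) = (if i = b then f b else (\<Sum>j\<in>?T. c i j))" for i
    proof (cases "i = b")
      case True
      have "(\<Sum>j\<in>S. e b j) = (\<Sum>j\<in>S. if j = a then f b else 0)"
        unfolding e_def c0 by simp
      then show ?thesis
        using True a less.prems(1) by simp
    next
      case False
      have "(\<Sum>j\<in>S. c i j) = c i b + (\<Sum>j\<in>?T. c i j)"
        using less.prems(1) b by (rule sum.remove)
      then show ?thesis
        using False by (simp add: e_def c0)
    qed
    have inc: "(\<Sum>j\<in>S. e j i) = (if i = a then f b else 0) + (\<Sum>j\<in>?T. c j i)" for i
    proof -
      have "(\<Sum>j\<in>S. e j i) = e b i + (\<Sum>j\<in>?T. e j i)"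
        using less.prems(1) b by (rule sum.remove)
      also have "e b i = (if i = a then f b else 0)"
        unfolding e_def c0 by simp
      also have "(\<Sum>j\<in>?T. e j i) = (\<Sum>j\<in>?T. c j i)"
        by (rule sum.cong) (auto simp: e_def)
      finally show ?thesis .
    qed
    show ?thesis
    proof (intro exI[of _ e] conjI allI ballI impI)
      show "e i j \<in> group_closure A" for i j
        using c(1) less.prems(3) b by (simp add: e_def)
      show "e i j = 0" if "i \<notin> S \<or> j \<notin> S" for i j
        using that a b c(2) by (auto simp: e_def)
      show "(\<Sum>j\<in>S. e i j) - (\<Sum>j\<in>S. e j i) = f i" if "i \<in> S" for i
        using c(3)[of i] that \<open>a \<noteq> b\<close> unfolding out inc
        by (auto simp: g_def c0 algebra_simps split: if_splits)
      show "v (e i j) * D i j \<le> K" if "i \<in> S" "j \<in> S" for i j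
      proof (cases "i = b \<and> j = a")
        case True
        \<comment> \<open>The new shipment costs \<open>v (f b) * \<delta>\<close>, which is the
          bound \<open>single\<close> at the extreme radius \<open>r = \<delta>\<close>.\<close>
        then show ?thesis
          using single[OF b \<delta>] D(3)[OF a b] by (simp add: e_def \<delta>_def)
      next
        case False
        then show ?thesis
          using that c(4)[of i j] \<open>0 \<le> K\<close> by (cases "i = b \<or> j = b") (auto simp: e_def c0)
      qed
    qed
  qed
qed

section \<open>Masses of balls as linear functionals\<close>

text \<open>
  The mass of \<open>u\<close> in \<open>B\<close>. Subtracting the indicator at \<open>0\<close> amounts to giving the zero vector the
  coefficient \<open>- coeff_sum u\<close>.
\<close>

definition ball_mass :: "('a \<Rightarrow>\<^sub>0 'f::field) set \<Rightarrow> ('a \<Rightarrow>\<^sub>0 'f) \<Rightarrow> 'f" where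
  "ball_mass B u = (\<Sum>a\<in>Poly_Mapping.keys u.
     Poly_Mapping.lookup u a * (of_bool (Poly_Mapping.single a 1 \<in> B) - of_bool (0 \<in> B)))"

text \<open>Different vectors have different \<open>keys\<close>; a common finite index set lets
  additivity and homogeneity be checked termwise.\<close>

lemma ball_mass_superset:
  assumes "finite T" "Poly_Mapping.keys u \<subseteq> T"
  shows "ball_mass B u = (\<Sum>a\<in>T.
     Poly_Mapping.lookup u a * (of_bool (Poly_Mapping.single a 1 \<in> B) - of_bool (0 \<in> B)))"
  unfolding ball_mass_def
  by (rule sum.mono_neutral_left) (use assms in \<open>auto simp: in_keys_iff\<close>)

lemma ball_mass_add: "ball_mass B (u + w) = ball_mass B u + ball_mass B w"
proof -
  let ?T = "Poly_Mapping.keys u \<union> Poly_Mapping.keys w"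
  have T: "finite ?T" "Poly_Mapping.keys (u + w) \<subseteq> ?T"
    "Poly_Mapping.keys u \<subseteq> ?T" "Poly_Mapping.keys w \<subseteq> ?T"
    using keys_add[of u w] by auto
  show ?thesis
    unfolding ball_mass_superset[OF T(1,2)] ball_mass_superset[OF T(1,3)]
      ball_mass_superset[OF T(1,4)]
    by (simp add: lookup_add distrib_right sum.distrib)
qed

lemma ball_mass_smul: "ball_mass B (smul s u) = s * ball_mass B u"
proof -
  have T: "Poly_Mapping.keys (smul s u) \<subseteq> Poly_Mapping.keys u"
    by (auto simp: in_keys_iff lookup_smul)
  show ?thesis
    unfolding ball_mass_superset[OF finite_keys T]
    by (simp add: ball_mass_def lookup_smul sum_distrib_left mult.assoc)
qed

lemma ball_mass_zero [simp]: "ball_mass B 0 = 0"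
  by (simp add: ball_mass_def)

lemma ball_mass_diff: "ball_mass B (u - w) = ball_mass B u - ball_mass B w"
  using ball_mass_add[of B "u - w" w] by simp

lemma ball_mass_sum: "ball_mass B (\<Sum>i\<in>I. g i) = (\<Sum>i\<in>I. ball_mass B (g i))"
  by (induction I rule: infinite_finite_induct) (simp_all add: ball_mass_add)

text \<open>The indicator at 0 cancels in a difference of two such vectors, so the mass of
  \<open>x - y\<close> is nonzero exactly when \<open>B\<close> separates \<open>x\<close> from
  \<open>y\<close>.\<close>

lemma ball_mass_gens0:
  assumes "x \<in> gens0"
  shows "ball_mass B x = of_bool (x \<in> B) - of_bool (0 \<in> B)"
  using assms by (auto simp: gens0_def gens_def ball_mass_def)

text \<open>The set \<open>{0}\<close> contains no basis vector, so only the mass given to the zero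
  vector is counted.\<close>

lemma coeff_sum_eq_ball_mass: "coeff_sum u = - ball_mass {0} u"
  by (simp add: coeff_sum_def ball_mass_def sum_negf)

section \<open>The ultra-seminorm defined by ball masses\<close>

text \<open>Radius 0 contributes the value 0, so the set is never empty and its supremum is
  nonnegative. The balls are not cut down to \<open>gens0\<close>, because \<open>ball_mass\<close>
  tests only basis vectors and 0.\<close>

definition ball_costs ::
  "('f::field \<Rightarrow> real) \<Rightarrow> (('a \<Rightarrow>\<^sub>0 'f) \<Rightarrow> ('a \<Rightarrow>\<^sub>0 'f) \<Rightarrow> real) \<Rightarrow> ('a \<Rightarrow>\<^sub>0 'f) \<Rightarrow> real set" where
  "ball_costs v d u = {v (ball_mass {z. d y z < r} u) * r | y r. y \<in> gens0 \<and> 0 \<le> r}"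

definition ball_norm ::
  "('f::field \<Rightarrow> real) \<Rightarrow> (('a \<Rightarrow>\<^sub>0 'f) \<Rightarrow> ('a \<Rightarrow>\<^sub>0 'f) \<Rightarrow> real) \<Rightarrow> ('a \<Rightarrow>\<^sub>0 'f) \<Rightarrow> real" where
  "ball_norm v d u = Sup (ball_costs v d u)"

context
  fixes v :: "'f::field \<Rightarrow> real" and d :: "('a \<Rightarrow>\<^sub>0 'f) \<Rightarrow> ('a \<Rightarrow>\<^sub>0 'f) \<Rightarrow> real"
  assumes v: "nonarch_valuation v" and d: "ultra_pseudometric_on gens0 d"
begin

lemma valuation:
  "0 \<le> v a" "v 0 = 0" "v (a * b) = v a * v b" "v (a + b) \<le> max (v a) (v b)" "v 1 = 1"
proof -
  have *: "\<And>a b. v (a * b) = v a * v b" "\<And>a. v a = 0 \<longleftrightarrow> a = 0"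
    using v by (auto simp: nonarch_valuation_def)
  show "0 \<le> v a" "v 0 = 0" "v (a * b) = v a * v b" "v (a + b) \<le> max (v a) (v b)"
    using v by (auto simp: nonarch_valuation_def)
  show "v 1 = 1"
    using *(1)[of 1 1] *(2)[of 1] by simp
qed

lemma ultra_pseudometric:
  assumes "x \<in> gens0" "y \<in> gens0"
  shows "0 \<le> d x y" "d x x = 0" "d x y = d y x" "z \<in> gens0 \<Longrightarrow> d x z \<le> max (d x y) (d y z)"
  using d assms unfolding ultra_pseudometric_on_def by blast+

lemma zero_in_gens0: "0 \<in> gens0"
  by (simp add: gens0_def)

text \<open>A ball that does not separate \<open>x\<close> from \<open>y\<close> gives mass 0. One
  that separates them gives mass 1 or -1, and by the strong triangle inequality its radius is at
  most \<open>d x y\<close>.\<close>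

lemma ball_cost_diff_le:
  assumes "x \<in> gens0" "y \<in> gens0" "z \<in> gens0" "0 \<le> r"
  shows "v (ball_mass {w. d z w < r} (x - y)) * r \<le> d x y"
proof (cases "d z x < r \<longleftrightarrow> d z y < r")
  case True
  then show ?thesis
    using assms ultra_pseudometric(1)[OF assms(1,2)]
    by (simp add: ball_mass_diff ball_mass_gens0 valuation)
next
  case False
  then have "r \<le> d x y"
    using ultra_pseudometric(4)[OF assms(3,1,2)] ultra_pseudometric(4)[OF assms(3,2,1)]
      ultra_pseudometric(3)[OF assms(1,2)] by auto
  moreover have "v (ball_mass {w. d z w < r} (x - y)) = 1"
    using False assms nonarch_valuation_minus[OF v, of 1]
    by (auto simp: ball_mass_diff ball_mass_gens0 valuation)
  ultimately show ?thesis by simp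
qed

lemma ball_costs_nonempty: "0 \<in> ball_costs v d u"
  unfolding ball_costs_def using zero_in_gens0 by force

lemma ball_cost_add_le:
  assumes "0 \<le> r"
  shows "v (ball_mass B (u + w)) * r \<le> max (v (ball_mass B u) * r) (v (ball_mass B w) * r)"
  using valuation(4)[of "ball_mass B u" "ball_mass B w"] assms
  by (auto simp: ball_mass_add max_def dest: mult_right_mono[OF _ assms] split: if_splits)

lemma bdd_above_ball_costs_iff:
  "bdd_above (ball_costs v d u) \<longleftrightarrow>
    (\<exists>M. \<forall>y\<in>gens0. \<forall>r\<ge>0. v (ball_mass {z. d y z < r} u) * r \<le> M)"
  unfolding bdd_above_def ball_costs_def by blast

lemma bdd_above_ball_costs_single: "bdd_above (ball_costs v d (Poly_Mapping.single a s))"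
  unfolding bdd_above_ball_costs_iff
proof (intro exI ballI allI impI)
  fix y :: "'a \<Rightarrow>\<^sub>0 'f" and r :: real
  assume yr: "y \<in> gens0" "0 \<le> r"
  let ?x = "Poly_Mapping.single a (1::'f)"
  have x: "?x \<in> gens0"
    by (auto simp: gens0_def gens_def)
  \<comment> \<open>As a difference of two points of \<open>gens0\<close>, the basis vector falls
    under \<open>ball_cost_diff_le\<close>.\<close>
  have "Poly_Mapping.single a s = smul s (?x - 0)"
    by (simp add: smul_single)
  then have "v (ball_mass {z. d y z < r} (Poly_Mapping.single a s)) * r
      = v s * (v (ball_mass {z. d y z < r} (?x - 0)) * r)"
    by (simp only: ball_mass_smul valuation mult.assoc)
  also have "\<dots> \<le> v s * d ?x 0"
    by (intro mult_left_mono ball_cost_diff_le x zero_in_gens0 yr valuation)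
  finally show "v (ball_mass {z. d y z < r} (Poly_Mapping.single a s)) * r \<le> v s * d ?x 0" .
qed

lemma bdd_above_ball_costs_add:
  assumes "bdd_above (ball_costs v d u)" "bdd_above (ball_costs v d w)"
  shows "bdd_above (ball_costs v d (u + w))"
proof -
  from assms obtain M N where
    M: "\<And>y r. y \<in> gens0 \<Longrightarrow> 0 \<le> r \<Longrightarrow> v (ball_mass {z. d y z < r} u) * r \<le> M" and
    N: "\<And>y r. y \<in> gens0 \<Longrightarrow> 0 \<le> r \<Longrightarrow> v (ball_mass {z. d y z < r} w) * r \<le> N"
    unfolding bdd_above_ball_costs_iff by blast
  have "v (ball_mass {z. d y z < r} (u + w)) * r \<le> max M N" if "y \<in> gens0" "0 \<le> r" for y r
    by (rule order_trans[OF ball_cost_add_le[OF that(2)] max.mono[OF M[OF that] N[OF that]]])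
  then show ?thesis
    unfolding bdd_above_ball_costs_iff by blast
qed

text \<open>A supremum of reals is meaningful only for a bounded set. Multiples of basis vectors
  have bounded costs, boundedness passes to sums, and \<open>u\<close> is a finite sum of such
  multiples.\<close>

lemma bdd_above_ball_costs: "bdd_above (ball_costs v d u)"
proof -
  have "bdd_above (ball_costs v d
      (\<Sum>a\<in>K. Poly_Mapping.single a (Poly_Mapping.lookup u a)))" if "finite K" for K
    using that
  proof (induction K rule: finite_induct)
    case empty
    then show ?case
      using bdd_above_ball_costs_single[of undefined 0] by simp
  next
    case (insert a K)
    then show ?case
      by (simp add: bdd_above_ball_costs_add bdd_above_ball_costs_single)
  qed
  from this[OF finite_keys, of u] show ?thesis
    by (simp add: sum_single_lookup)
qed

lemma ball_cost_le_ball_norm: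
  assumes "y \<in> gens0" "0 \<le> r"
  shows "v (ball_mass {z. d y z < r} u) * r \<le> ball_norm v d u"
  unfolding ball_norm_def
  by (rule cSup_upper[OF _ bdd_above_ball_costs]) (use assms in \<open>auto simp: ball_costs_def\<close>)

lemma ball_norm_le:
  assumes "\<And>y r. y \<in> gens0 \<Longrightarrow> 0 \<le> r \<Longrightarrow> v (ball_mass {z. d y z < r} u) * r \<le> M"
  shows "ball_norm v d u \<le> M"
  unfolding ball_norm_def
proof (rule cSup_least)
  show "ball_costs v d u \<noteq> {}"
    using ball_costs_nonempty by blast
qed (use assms in \<open>auto simp: ball_costs_def\<close>)

lemma ball_norm_nonneg: "0 \<le> ball_norm v d u"
  unfolding ball_norm_def by (rule cSup_upper[OF ball_costs_nonempty bdd_above_ball_costs])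

lemma ultra_seminorm_ball_norm: "ultra_seminorm v (ball_norm v d)"
  unfolding ultra_seminorm_def
proof (intro conjI allI)
  \<comment> \<open>The supremum yields only this inequality directly; the reverse one follows below
    by applying it to \<open>inverse s\<close>.\<close>
  have smul_le: "ball_norm v d (smul s u) \<le> v s * ball_norm v d u" for s u
  proof (rule ball_norm_le)
    show "v (ball_mass {z. d y z < r} (smul s u)) * r \<le> v s * ball_norm v d u"
      if "y \<in> gens0" "0 \<le> r" for y r
      using mult_left_mono[OF ball_cost_le_ball_norm[OF that] valuation(1)]
      by (simp add: ball_mass_smul valuation mult.assoc)
  qed
  show "0 \<le> ball_norm v d u" for u
    by (rule ball_norm_nonneg)
  show zero: "ball_norm v d 0 = 0"
    using ball_norm_le[of 0 0] ball_norm_nonneg[of 0] by (simp add: valuation)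
  show "ball_norm v d (u + w) \<le> max (ball_norm v d u) (ball_norm v d w)" for u w
    by (intro ball_norm_le order_trans[OF ball_cost_add_le] max.mono ball_cost_le_ball_norm)
  show "ball_norm v d (smul s u) = v s * ball_norm v d u" for s u
  proof (cases "s = 0")
    case False
    have inv: "v s * v (inverse s) = 1"
      using False by (simp flip: valuation(3) add: valuation)
    have "u = smul (inverse s) (smul s u)"
      using False by (intro poly_mapping_eqI) (simp add: lookup_smul)
    then have "v s * ball_norm v d u \<le> v s * (v (inverse s) * ball_norm v d (smul s u))"
      using smul_le[of "inverse s" "smul s u"] valuation(1) by (simp add: mult_left_mono)
    also have "\<dots> = ball_norm v d (smul s u)"
      using inv by (simp flip: mult.assoc)
    finally show ?thesis
      using smul_le[of s u] by simp
  qed (simp add: zero valuation)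
qed

lemma seminorm_extends_ball_norm: "seminorm_extends d (ball_norm v d)"
  unfolding seminorm_extends_def
proof (intro ballI antisym)
  fix x y :: "'a \<Rightarrow>\<^sub>0 'f"
  assume xy: "x \<in> gens0" "y \<in> gens0"
  show "ball_norm v d (x - y) \<le> d x y"
    by (intro ball_norm_le ball_cost_diff_le xy)
  show "d x y \<le> ball_norm v d (x - y)"
  proof (cases "d x y = 0")
    case False
    \<comment> \<open>The open ball of radius \<open>d x y\<close> around \<open>x\<close> contains
      \<open>x\<close> but not \<open>y\<close>, so its cost is exactly
      \<open>d x y\<close>.\<close>
    then have "ball_mass {z. d x z < d x y} (x - y) = 1"
      using ultra_pseudometric(1,2)[OF xy] by (simp add: ball_mass_diff ball_mass_gens0 xy)
    then show ?thesis
      using ball_cost_le_ball_norm[OF xy(1), of "d x y" "x - y"] ultra_pseudometric(1)[OF xy]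
      by (simp add: valuation)
  qed (simp add: ball_norm_nonneg)
qed

end

section \<open>Uniqueness of the Kantorovich ultra-seminorm, normal forms and supports\<close>

lemma kantorovich_eqI:
  assumes "is_kantorovich v d p"
  shows "kantorovich v d = p"
  unfolding kantorovich_def
proof (rule the_equality)
  show "is_kantorovich v d p"
    by (rule assms)
next
  fix q
  assume "is_kantorovich v d q"
  then show "q = p"
    using assms unfolding is_kantorovich_def by (intro ext antisym) blast+
qed

text \<open>Injectivity of \<open>x\<close> prevents terms from merging and
  \<open>lam i \<noteq> 0\<close> prevents them from vanishing, so each index contributes exactly
  one key.\<close>

lemma normal_form_keys:
  assumes "normal_form u n lam x"
  shows "(\<lambda>a. Poly_Mapping.single a 1) ` Poly_Mapping.keys u = x ` {1..n}"
proof -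
  from assms have "\<forall>i\<in>{1..n}. \<exists>a. x i = Poly_Mapping.single a 1"
    by (auto simp: normal_form_def gens_def)
  then obtain a where a: "\<And>i. i \<in> {1..n} \<Longrightarrow> x i = Poly_Mapping.single (a i) 1"
    by metis
  have inj: "inj_on a {1..n}"
    using assms a unfolding normal_form_def inj_on_def by metis
  have "u = (\<Sum>i=1..n. Poly_Mapping.single (a i) (lam i))"
    using assms a by (simp add: normal_form_def smul_single)
  then have *: "Poly_Mapping.lookup u b = (\<Sum>i=1..n. lam i when a i = b)" for b
    by (simp add: lookup_sum lookup_single)
  have "Poly_Mapping.lookup u (a i) = lam i" if "i \<in> {1..n}" for i
  proof -
    have "Poly_Mapping.lookup u (a i) = (\<Sum>j=1..n. if j = i then lam i else 0)"
      unfolding *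
      by (rule sum.cong) (use that in \<open>auto simp: when_def inj_on_eq_iff[OF inj]\<close>)
    then show ?thesis
      using that by simp
  qed
  moreover have "Poly_Mapping.lookup u b = 0" if "b \<notin> a ` {1..n}" for b
    unfolding * by (rule sum.neutral) (use that in \<open>auto simp: when_def\<close>)
  ultimately have "Poly_Mapping.keys u = a ` {1..n}"
    using assms by (force simp: in_keys_iff normal_form_def)
  then show ?thesis
    using a by (force simp: image_iff)
qed

text \<open>Linearity of \<open>ball_mass\<close> moves the sum from \<open>keys\<close> to the
  given enumeration; the coefficient sum is the case \<open>B = {0}\<close> up to sign.\<close>

lemma normal_form_sums:
  assumes "normal_form u n lam x"
  shows "ball_mass B u = (\<Sum>i=1..n. lam i * (of_bool (x i \<in> B) - of_bool (0 \<in> B)))"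
    and "coeff_sum u = (\<Sum>i=1..n. lam i)"
proof -
  have x: "x i \<in> gens0" "x i \<noteq> 0" if "i \<in> {1..n}" for i
    using assms that by (metis gens0_def insertCI normal_form_def)
       (metis assms normal_form_def that zero_notin_gens)
  have u: "u = (\<Sum>i=1..n. smul (lam i) (x i))"
    using assms by (simp add: normal_form_def)
  show *: "ball_mass B u = (\<Sum>i=1..n. lam i * (of_bool (x i \<in> B) - of_bool (0 \<in> B)))" for B
    unfolding u ball_mass_sum ball_mass_smul
    by (intro sum.cong refl) (simp add: ball_mass_gens0 x)
  show "coeff_sum u = (\<Sum>i=1..n. lam i)"
    unfolding coeff_sum_eq_ball_mass * sum_negf[symmetric]
    by (intro sum.cong refl) (simp add: x)
qed

text \<open>The vectors enumerated up to \<open>n\<close> are basis vectors and hence nonzero, so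
  when 0 lies in the support only the last index \<open>Suc n\<close> can name it.\<close>

lemma normal_form_supp_cases:
  assumes nf: "normal_form u n lam x" and m: "m = card (supp u)" and s: "supp u = x ` {1..m}"
  obtains "m = n" "(\<Sum>i=1..n. lam i) = 0" | "m = Suc n" "x m = 0"
proof -
  have x: "x i \<noteq> 0" if "i \<in> {1..n}" for i
    using nf that by (metis normal_form_def zero_notin_gens)
  have card: "card (x ` {1..n}) = n"
    using nf by (simp add: normal_form_def card_image)
  show thesis
  proof (cases "u \<in> L0")
    case True
    then have "supp u = x ` {1..n}"
      by (simp add: supp_def normal_form_keys[OF nf])
    then show thesis
      using m card that(1) True normal_form_sums(2)[OF nf] by (simp add: L0_def)
  next
    case False
    then have *: "supp u = insert 0 (x ` {1..n})"
      by (simp add: supp_def normal_form_keys[OF nf])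
    have "m = Suc n"
      unfolding m * using card x by (subst card_insert_disjoint) auto
    moreover have "0 \<in> x ` {1..m}"
      using * s by auto
    ultimately show thesis
      using that(2) x by (auto simp: atLeastAtMostSuc_conv)
  qed
qed

section \<open>Admissible plans as decompositions of the vector\<close>

text \<open>Exchanging the summations in the subtracted part collects the coefficient of each
  \<open>x i\<close> as outflow minus inflow. The flow condition covers the indices up to
  \<open>n\<close>, and a further index carries the zero vector.\<close>

lemma admissible_decomposition:
  assumes nf: "normal_form u n lam x" and m: "m = n \<or> (m = Suc n \<and> x m = 0)"
    and c: "admissible m n lam c"
  shows "u = (\<Sum>i=1..m. \<Sum>j=1..m. smul (c i j) (x i - x j))"
proof -
  have "(\<Sum>i=1..m. \<Sum>j=1..m. smul (c i j) (x i - x j))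
      = (\<Sum>i=1..m. \<Sum>j=1..m. smul (c i j) (x i)) - (\<Sum>i=1..m. \<Sum>j=1..m. smul (c i j) (x j))"
    by (simp add: smul_diff_right sum_subtractf)
  also have "(\<Sum>i=1..m. \<Sum>j=1..m. smul (c i j) (x j)) = (\<Sum>i=1..m. \<Sum>j=1..m. smul (c j i) (x i))"
    by (rule sum.swap)
  also have "(\<Sum>i=1..m. \<Sum>j=1..m. smul (c i j) (x i)) - \<dots>
      = (\<Sum>i=1..m. smul ((\<Sum>j=1..m. c i j) - (\<Sum>j=1..m. c j i)) (x i))"
    by (simp add: smul_diff_left smul_sum_left sum_subtractf)
  also have "\<dots> = (\<Sum>i=1..n. smul ((\<Sum>j=1..m. c i j) - (\<Sum>j=1..m. c j i)) (x i))"
    using m by auto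
  also have "\<dots> = (\<Sum>i=1..n. smul (lam i) (x i))"
    using c by (intro sum.cong refl) (simp add: admissible_def)
  also have "\<dots> = u"
    using nf by (simp add: normal_form_def)
  finally show ?thesis by simp
qed

text \<open>The strong triangle inequality for \<open>q\<close> is applied to the decomposition
  given by the plan. This serves twice: for the competitors of \<open>ball_norm\<close>, and with
  \<open>q = ball_norm v d\<close> as the lower bound on all costs.\<close>

lemma seminorm_le_plan_cost:
  assumes q: "ultra_seminorm v q" "seminorm_extends d q"
    and nf: "normal_form u n lam x" and m: "m = n \<or> (m = Suc n \<and> x m = 0)" and "1 \<le> m"
    and x: "\<And>i. i \<in> {1..m} \<Longrightarrow> x i \<in> gens0"
    and c: "admissible m n lam c"
  shows "q u \<le> plan_cost v d m x c"
proof -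
  have q_smul: "q (smul (c i j) (x i - x j)) = v (c i j) * d (x i) (x j)"
    if "i \<in> {1..m}" "j \<in> {1..m}" for i j
    using q x that by (simp add: ultra_seminorm_def seminorm_extends_def)
  have le: "v (c i j) * d (x i) (x j) \<le> plan_cost v d m x c"
    if "i \<in> {1..m}" "j \<in> {1..m}" for i j
    using plan_cost_le_iff[OF \<open>1 \<le> m\<close>, of v d x c "plan_cost v d m x c"] that by blast
  \<comment> \<open>\<open>ultra_seminorm_sum_le\<close> requires a nonnegative bound; the diagonal
    entry at index 1 provides it.\<close>
  have "0 \<le> q (smul (c 1 1) (x 1 - x 1))"
    using q(1) by (simp add: ultra_seminorm_def)
  then have nonneg: "0 \<le> plan_cost v d m x c"
    using q_smul[of 1 1] le[of 1 1] \<open>1 \<le> m\<close> by simp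
  show ?thesis
    unfolding admissible_decomposition[OF nf m c]
    by (intro ultra_seminorm_sum_le[OF q(1)] nonneg) (simp_all add: q_smul le)
qed

section \<open>Plans that cost no more than the ball norm\<close>

text \<open>\<open>exists_flow\<close> is applied to the indices \<open>{1..m}\<close>, with
  \<open>d\<close> pulled back along \<open>x\<close> and \<open>K = ball_norm v d u\<close>; the
  masses of pulled-back balls are values of \<open>ball_mass\<close>.\<close>

lemma exists_admissible_plan:
  assumes v: "nonarch_valuation v" and d: "ultra_pseudometric_on gens0 d"
    and nf: "normal_form u n lam x"
    and m: "m = n \<and> (\<Sum>i=1..n. lam i) = 0 \<or> m = Suc n \<and> x m = 0"
    and "1 \<le> m" and x: "\<And>i. i \<in> {1..m} \<Longrightarrow> x i \<in> gens0"
  obtains c where "admissible m n lam c" "plan_cost v d m x c \<le> ball_norm v d u"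
proof -
  let ?G = "group_closure (lam ` {1..n})"
  \<comment> \<open>The index \<open>Suc n\<close>, present only when \<open>m = Suc n\<close>,
    receives the mass that makes the total vanish.\<close>
  define f where "f i = (if i \<le> n then lam i else - (\<Sum>i=1..n. lam i))" for i
  \<comment> \<open>With \<open>h = 1\<close> this gives total mass 0, and with \<open>h\<close> the
    indicator of a ball it gives \<open>ball_mass\<close>. For \<open>m = n\<close> the term in
    \<open>h 0\<close> vanishes because the coefficients sum to 0.\<close>
  have sum_f: "(\<Sum>i=1..m. f i * h (x i)) = (\<Sum>i=1..n. lam i * (h (x i) - h 0))" for h
  proof -
    have "(\<Sum>i=1..n. f i * h (x i)) = (\<Sum>i=1..n. lam i * h (x i))"
      by (rule sum.cong) (auto simp: f_def)
    moreover have "(\<Sum>i=1..n. lam i * (h (x i) - h 0))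
        = (\<Sum>i=1..n. lam i * h (x i)) - (\<Sum>i=1..n. lam i) * h 0"
      by (simp add: right_diff_distrib sum_subtractf sum_distrib_right)
    ultimately show ?thesis
      using m by (auto simp: f_def)
  qed
  have lam_G: "i \<in> {1..n} \<Longrightarrow> lam i \<in> ?G" for i
    by (rule base) simp
  have "(\<Sum>i\<in>I. lam i) \<in> ?G" if "I \<subseteq> {1..n}" for I
    using finite_subset[OF that finite_atLeastAtMost] that
    by (induction I rule: finite_induct)
       (simp_all add: group_closure_add lam_G del: atLeastAtMost_iff One_nat_def)
  \<comment> \<open>The balancing mass is written as 0 minus a sum of coefficients, which keeps it
    in the group.\<close>
  then have f_G: "f i \<in> ?G" if "i \<in> {1..m}" for i
    using that lam_G[of i] diff[OF zero_in_group_closure, of "\<Sum>i=1..n. lam i"] by (auto simp: f_def)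
  have "\<exists>c. (\<forall>i j. c i j \<in> ?G) \<and> (\<forall>i j. i \<notin> {1..m} \<or> j \<notin> {1..m} \<longrightarrow> c i j = 0) \<and>
           (\<forall>i\<in>{1..m}. (\<Sum>j=1..m. c i j) - (\<Sum>j=1..m. c j i) = f i) \<and>
           (\<forall>i\<in>{1..m}. \<forall>j\<in>{1..m}. v (c i j) * d (x i) (x j) \<le> ball_norm v d u)"
  proof (rule exists_flow[OF v])
    show "0 \<le> ball_norm v d u"
      by (rule ball_norm_nonneg[OF v d])
    show "ultra_pseudometric_on {1..m} (\<lambda>i j. d (x i) (x j))"
      using d x unfolding ultra_pseudometric_on_def by blast
    show "sum f {1..m} = 0"
      using sum_f[of "\<lambda>_. 1"] by simp
    show "v (\<Sum>i\<in>{i \<in> {1..m}. d (x y) (x i) < r}. f i) * r \<le> ball_norm v d u"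
      if "y \<in> {1..m}" "0 \<le> r" for y r
    proof -
      have "(\<Sum>i\<in>{i \<in> {1..m}. d (x y) (x i) < r}. f i)
          = (\<Sum>i=1..m. f i * of_bool (x i \<in> {z. d (x y) z < r}))"
        unfolding sum.inter_filter[OF finite_atLeastAtMost] by (rule sum.cong) auto
      also have "\<dots> = ball_mass {z. d (x y) z < r} u"
        unfolding normal_form_sums(1)[OF nf]
        by (rule sum_f[of "\<lambda>z. of_bool (z \<in> {z'. d (x y) z' < r})"])
      finally show ?thesis
        using ball_cost_le_ball_norm[OF v d x[OF that(1)] that(2)] by simp
    qed
  qed (use f_G in auto)
  then obtain c where c: "\<And>i j. c i j \<in> ?G"
    "\<And>i. i \<in> {1..m} \<Longrightarrow> (\<Sum>j=1..m. c i j) - (\<Sum>j=1..m. c j i) = f i"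
    "\<And>i j. i \<in> {1..m} \<Longrightarrow> j \<in> {1..m} \<Longrightarrow> v (c i j) * d (x i) (x j) \<le> ball_norm v d u"
    by blast
  show thesis
  proof (rule that)
    show "admissible m n lam c"
      unfolding admissible_def using c(1,2) m by (auto simp: f_def)
    show "plan_cost v d m x c \<le> ball_norm v d u"
      unfolding plan_cost_le_iff[OF \<open>1 \<le> m\<close>] using c(3) by blast
  qed
qed

section \<open>Identification of the Kantorovich ultra-seminorm\<close>

text \<open>Maximality compares seminorms at every vector, so an enumerated normal form must be
  available for each.\<close>

lemma normal_form_exists:
  fixes u :: "'a \<Rightarrow>\<^sub>0 'f::field"
  obtains n lam x where "normal_form u n lam x" "supp u = x ` {1..card (supp u)}"
proof -
  obtain a where a: "bij_betw a {1..card (Poly_Mapping.keys u)} (Poly_Mapping.keys u)"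
    using ex_bij_betw_nat_finite_1[OF finite_keys] by blast
  define n where "n = card (Poly_Mapping.keys u)"
  \<comment> \<open>The default value 0 beyond \<open>n\<close> makes \<open>x (Suc n)\<close> name
    the zero vector when the support contains it.\<close>
  define x where "x i = (if i \<le> n then Poly_Mapping.single (a i) (1::'f) else 0)" for i
  have inj: "inj_on a {1..n}" and im: "a ` {1..n} = Poly_Mapping.keys u"
    using a by (auto simp: n_def bij_betw_def)
  have u: "u = (\<Sum>i=1..n. smul (Poly_Mapping.lookup u (a i)) (x i))"
  proof -
    have "u = (\<Sum>b\<in>a ` {1..n}. Poly_Mapping.single b (Poly_Mapping.lookup u b))"
      unfolding im by (rule sum_single_lookup[symmetric])
    also have "\<dots> = (\<Sum>i=1..n. Poly_Mapping.single (a i) (Poly_Mapping.lookup u (a i)))"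
      by (subst sum.reindex[OF inj]) simp
    also have "\<dots> = (\<Sum>i=1..n. smul (Poly_Mapping.lookup u (a i)) (x i))"
      by (intro sum.cong) (auto simp: x_def smul_single)
    finally show ?thesis .
  qed
  have nf: "normal_form u n (\<lambda>i. Poly_Mapping.lookup u (a i)) x"
    unfolding normal_form_def
  proof (intro conjI ballI)
    show "x i \<in> gens" if "i \<in> {1..n}" for i
      using that by (auto simp: x_def gens_def)
    show "inj_on x {1..n}"
    proof (rule inj_onI)
      fix i j
      assume ij: "i \<in> {1..n}" "j \<in> {1..n}" "x i = x j"
      then have "a i = a j"
        by (simp add: x_def single_one_eq_iff)
      then show "i = j"
        using inj_onD[OF inj] ij by blast
    qed
    show "Poly_Mapping.lookup u (a i) \<noteq> 0" if "i \<in> {1..n}" for i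
      using that im by (auto simp flip: in_keys_iff)
    show "u = (\<Sum>i=1..n. smul (Poly_Mapping.lookup u (a i)) (x i))"
      by (rule u)
  qed
  have card: "card (x ` {1..n}) = n"
    using nf by (simp add: normal_form_def card_image)
  have "0 \<notin> x ` {1..n}"
    by (auto simp: x_def)
  then have "supp u = x ` {1..card (supp u)}"
    using card normal_form_keys[OF nf]
    by (auto simp: supp_def atLeastAtMostSuc_conv x_def[of "Suc n"])
  with nf show thesis
    by (rule that)
qed

text \<open>This supplies \<open>1 \<le> m\<close>, so that \<open>plan_cost\<close> is a maximum
  over a nonempty set.\<close>

lemma supp_nonempty:
  assumes "u \<noteq> 0"
  shows "1 \<le> card (supp u)"
proof -
  have "supp u \<noteq> {}" "finite (supp u)"
    using assms by (auto simp: supp_def)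
  then show ?thesis
    by (simp add: Suc_le_eq card_gt_0_iff)
qed

lemma supp_subset_gens0: "supp u \<subseteq> gens0"
  by (auto simp: supp_def gens0_def gens_def)

text \<open>A competitor \<open>q\<close> lies below the cost of every admissible plan, and some
  such plan costs at most \<open>ball_norm v d u\<close>.\<close>

lemma kantorovich_eq_ball_norm:
  fixes v :: "'f::field \<Rightarrow> real" and d :: "('a \<Rightarrow>\<^sub>0 'f) \<Rightarrow> ('a \<Rightarrow>\<^sub>0 'f) \<Rightarrow> real"
  assumes v: "nonarch_valuation v" and d: "ultra_pseudometric_on gens0 d"
  shows "is_kantorovich v d (ball_norm v d)" "kantorovich v d = ball_norm v d"
proof -
  have "q u \<le> ball_norm v d u" if q: "ultra_seminorm v q" "seminorm_extends d q" for q u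
  proof (cases "u = 0")
    \<comment> \<open>The zero vector has empty support, where \<open>plan_cost\<close> would be a
      maximum over the empty set.\<close>
    case True
    then show ?thesis
      using q(1) ball_norm_nonneg[OF v d] by (simp add: ultra_seminorm_def)
  next
    case False
    obtain n lam x where nf: "normal_form u n lam x" and s: "supp u = x ` {1..card (supp u)}"
      by (rule normal_form_exists)
    let ?m = "card (supp u)"
    have m: "?m = n \<and> (\<Sum>i=1..n. lam i) = 0 \<or> ?m = Suc n \<and> x ?m = 0"
      by (rule normal_form_supp_cases[OF nf refl s]) auto
    have x: "x i \<in> gens0" if "i \<in> {1..?m}" for i
      using that s supp_subset_gens0[of u] by blast
    obtain c where c: "admissible ?m n lam c" "plan_cost v d ?m x c \<le> ball_norm v d u"
      using exists_admissible_plan[OF v d nf m supp_nonempty[OF False] x] by blast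
    have "q u \<le> plan_cost v d ?m x c"
      using m by (intro seminorm_le_plan_cost[OF q nf _ supp_nonempty[OF False] x c(1)]) auto
    with c(2) show ?thesis
      by simp
  qed
  then show "is_kantorovich v d (ball_norm v d)"
    using ultra_seminorm_ball_norm[OF v d] seminorm_extends_ball_norm[OF v d]
    by (simp add: is_kantorovich_def)
  then show "kantorovich v d = ball_norm v d"
    by (rule kantorovich_eqI)
qed

theorem theorem5p6:
  fixes v :: "'f::field \<Rightarrow> real"
    and d :: "('a \<Rightarrow>\<^sub>0 'f) \<Rightarrow> ('a \<Rightarrow>\<^sub>0 'f) \<Rightarrow> real"
    and u :: "'a \<Rightarrow>\<^sub>0 'f"
    and n m :: nat
    and lam :: "nat \<Rightarrow> 'f"
    and x :: "nat \<Rightarrow> ('a \<Rightarrow>\<^sub>0 'f)"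
  assumes "nonarch_valuation v"
    and "ultra_pseudometric_on gens0 d"
    and "u \<noteq> 0"
    and "normal_form u n lam x"
    and "m = card (supp u)"
    and "supp u = x ` {1..m}"
  shows "kantorovich v d u \<in> {plan_cost v d m x c | c. admissible m n lam c} \<and>
         (\<forall>r\<in>{plan_cost v d m x c | c. admissible m n lam c}. kantorovich v d u \<le> r)"
proof -
  have cases: "m = n \<and> (\<Sum>i=1..n. lam i) = 0 \<or> m = Suc n \<and> x m = 0"
    by (rule normal_form_supp_cases[OF assms(4-6)]) auto
  have m: "1 \<le> m"
    using supp_nonempty[OF assms(3)] assms(5) by simp
  have x: "x i \<in> gens0" if "i \<in> {1..m}" for i
    using that assms(6) supp_subset_gens0[of u] by blast
  \<comment> \<open>\<open>ball_norm v d\<close> is itself an ultra-seminorm extending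
    \<open>d\<close>, so no admissible plan is cheaper.\<close>
  have le: "ball_norm v d u \<le> plan_cost v d m x c" if "admissible m n lam c" for c
    using cases
    by (intro seminorm_le_plan_cost[OF ultra_seminorm_ball_norm[OF assms(1,2)]
          seminorm_extends_ball_norm[OF assms(1,2)] assms(4) _ m x that]) auto
  obtain c where c: "admissible m n lam c" "plan_cost v d m x c \<le> ball_norm v d u"
    using exists_admissible_plan[OF assms(1,2,4) cases m x] by blast
  have "ball_norm v d u = plan_cost v d m x c"
    using le[OF c(1)] c(2) by simp
  then show ?thesis
    unfolding kantorovich_eq_ball_norm(2)[OF assms(1,2)] using c(1) le by blast
qed

end
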